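(* Let $n$ be a positive integer, $\omega=\exp(2\pi i/n)$ and $0\le j<n$. Let $$\check R=\begin{bmatrix}\omega^j&0&0&0\\0&0&\omega^{-j}&0\\0&\omega^{-j}&0&0\\0&0&0&\omega^j\end{bmatrix}.$$ Then $$\check R(x)=(\omega^j-\omega^{-3j})\,x\,I\otimes I-(x-1)\check R-\omega^{-2j}x(x-1)\check R^{-1}=\begin{bmatrix}\omega^j-\omega^{-3j}x^2&0&0&0\\0&(\omega^j-\omega^{-3j})x&-\omega^{-j}(x^2-1)&0\\0&-\omega^{-j}(x^2-1)&(\omega^j-\omega^{-3j})x&0\\0&0&0&\omega^j-\omega^{-3j}x^2\end{bmatrix}$$ satisfies the braiding Yang--Baxter equation $$\check R_{12}(x)\check R_{23}(xz)\check R_{12}(z)=\check R_{23}(z)\check R_{12}(xz)\check R_{23}(x)$$ for all nonzero $x,z\in\mathbb C$. Moreover, the rescaled matrix $$\check S(x)=\omega^jx^{-1}\check R(x)=\begin{bmatrix}\omega^{2j}x^{-1}-\omega^{-2j}x&0&0&0\\0&\omega^{2j}-\omega^{-2j}&x^{-1}-x&0\\0&x^{-1}-x&\omega^{2j}-\omega^{-2j}&0\\0&0&0&\omega^{2j}x^{-1}-\omega^{-2j}x\end{bmatrix}$$ also satisfies this equation and satisfies the unitarity relation $\check S(x)\check S(x^{-1})=\left[\omega^{4j}+\omega^{-4j}-(x^2+x^{-2})\right]I\otimes I$ for all nonzero $x\in\mathbb{C}$.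
   Context: Matrices of size $4\times4$ are operators on $V\otimes V$ with $V=\mathbb C^2$, in the basis $e_1\otimes e_1,e_1\otimes e_2,e_2\otimes e_1,e_2\otimes e_2$; $I$ is the identity on $V$. For an operator $M$ on $V\otimes V$, $M_{12}=M\otimes I$ and $M_{23}=I\otimes M$ on $V\otimes V\otimes V$. *)

theory Defs
  imports Complex_Main "Jordan_Normal_Form.Gauss_Jordan_Elimination"
begin

text \<open>
  Matrix of the tensor product of two operators. Row and column indices are pairs in
  lexicographic order, i.e. the pair \<open>(p, q)\<close> has index \<open>p * dim B + q\<close>, so that for
  \<open>2 \<times> 2\<close> factors the underlying basis is
  \<open>e\<^sub>1 \<otimes> e\<^sub>1, e\<^sub>1 \<otimes> e\<^sub>2, e\<^sub>2 \<otimes> e\<^sub>1, e\<^sub>2 \<otimes> e\<^sub>2\<close>.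
\<close>

definition kron :: "complex mat \<Rightarrow> complex mat \<Rightarrow> complex mat" (infixl "\<otimes>\<^sub>K" 72) where
  "A \<otimes>\<^sub>K B = mat (dim_row A * dim_row B) (dim_col A * dim_col B)
     (\<lambda>(r, c). A $$ (r div dim_row B, c div dim_col B) * B $$ (r mod dim_row B, c mod dim_col B))"

definition leg12 :: "complex mat \<Rightarrow> complex mat" where
  "leg12 M = M \<otimes>\<^sub>K 1\<^sub>m 2"

definition leg23 :: "complex mat \<Rightarrow> complex mat" where
  "leg23 M = 1\<^sub>m 2 \<otimes>\<^sub>K M"

definition braiding_YBE :: "(complex \<Rightarrow> complex mat) \<Rightarrow> bool" where
  "braiding_YBE T \<longleftrightarrow> (\<forall>x z. x \<noteq> 0 \<longrightarrow> z \<noteq> 0 \<longrightarrow>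
     leg12 (T x) * leg23 (T (x * z)) * leg12 (T z)
     = leg23 (T z) * leg12 (T (x * z)) * leg23 (T x))"

definition R_check :: "complex \<Rightarrow> nat \<Rightarrow> complex mat" where
  "R_check w j = mat_of_rows_list 4
     [[w ^ j, 0, 0, 0],
      [0, 0, w powi (- int j), 0],
      [0, w powi (- int j), 0, 0],
      [0, 0, 0, w ^ j]]"

definition R_check_spec :: "complex \<Rightarrow> nat \<Rightarrow> complex \<Rightarrow> complex mat" where
  "R_check_spec w j x =
     ((w ^ j - w powi (- 3 * int j)) * x) \<cdot>\<^sub>m (1\<^sub>m 2 \<otimes>\<^sub>K 1\<^sub>m 2)
     - (x - 1) \<cdot>\<^sub>m R_check w j
     - (w powi (- 2 * int j) * x * (x - 1)) \<cdot>\<^sub>m the (mat_inverse (R_check w j))"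

definition S_check :: "complex \<Rightarrow> nat \<Rightarrow> complex \<Rightarrow> complex mat" where
  "S_check w j x = (w ^ j * inverse x) \<cdot>\<^sub>m R_check_spec w j x"

end

theory Submission
  imports Defs
begin

text \<open>
  All matrices involved have the shape of a symmetric six-vertex weight matrix: a corner entry
  \<open>a\<close> and a middle block with diagonal \<open>c\<close> and off-diagonal \<open>b\<close>. These matrices are closed under
  products and linear combinations, so the inverse of \<open>R_check\<close>, the closed forms and the
  unitarity relation become identities between the three parameters.

  For the braiding equation, the operators on \<open>V \<otimes> V \<otimes> V\<close> preserve the number of factors
  \<open>e\<^sub>2\<close> in a basis vector and are invariant under exchanging \<open>e\<^sub>1\<close> and \<open>e\<^sub>2\<close>. Everything therefore
  happens in one \<open>3 \<times> 3\<close> block, where the equation amounts to three cubic relations between the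
  weights at \<open>x\<close>, \<open>xz\<close> and \<open>z\<close> (lemma \<open>star_triangle\<close>). For the weights
  \<open>a = p - r x\<^sup>2\<close>, \<open>b = - s (x\<^sup>2 - 1)\<close>, \<open>c = (p - r) x\<close>
  two of the relations are polynomial identities, and in the third the two sides differ by a
  multiple of \<open>p r - s\<^sup>2\<close> (lemma \<open>trigonometric_six_vertex_YBE\<close>). The matrix of the theorem has
  \<open>p = \<omega>\<^sup>j\<close>, \<open>r = p\<^sup>-\<^sup>3\<close> and \<open>s = p\<^sup>-\<^sup>1\<close>, so \<open>p r = s\<^sup>2\<close>.

  Both sides of the equation are homogeneous in the operators at \<open>x\<close>, \<open>xz\<close> and \<open>z\<close>, hence it
  survives multiplying the operator at \<open>x\<close> by any scalar function of \<open>x\<close>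
  (lemma \<open>braiding_YBE_smult\<close>); this transfers it to the rescaled matrix.
\<close>

section \<open>Six-vertex matrices\<close>

definition six_vertex :: "complex \<Rightarrow> complex \<Rightarrow> complex \<Rightarrow> complex mat" where
  "six_vertex a b c = mat_of_rows_list 4
     [[a, 0, 0, 0], [0, c, b, 0], [0, b, c, 0], [0, 0, 0, a]]"

lemma index_mat_of_rows_list [simp]:
  "i < length rs \<Longrightarrow> j < n \<Longrightarrow> mat_of_rows_list n rs $$ (i, j) = rs ! i ! j"
  by (simp add: mat_of_rows_list_def)

lemma mat_of_rows_list_square: "length rs = n \<Longrightarrow> mat_of_rows_list n rs \<in> carrier_mat n n"
  by (simp add: mat_of_rows_list_def)

lemma six_vertex_carrier [simp]: "six_vertex a b c \<in> carrier_mat 4 4"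
  unfolding six_vertex_def by (rule mat_of_rows_list_square) simp

lemma dim_six_vertex [simp]:
  "dim_row (six_vertex a b c) = 4" "dim_col (six_vertex a b c) = 4"
  by (rule carrier_matD[OF six_vertex_carrier])+

lemma square_mat_eqI:
  assumes "A \<in> carrier_mat n n" and "B \<in> carrier_mat n n"
    and "\<forall>i<n. \<forall>j<n. A $$ (i, j) = B $$ (i, j)"
  shows "A = B"
  using assms by (intro eq_matI) auto

text \<open>
  The sum over a common index range lets a matrix product be expanded entry by entry while the
  factors stay folded; unfolding them inside the scalar product of a row and a column
  makes the expressions explode.
\<close>
lemma index_square_mult:
  assumes "A \<in> carrier_mat n n" and "B \<in> carrier_mat n n" and "i < n" and "j < n"
  shows "(A * B) $$ (i, j) = (\<Sum>k = 0..<n. A $$ (i, k) * B $$ (k, j))"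
  using assms by (simp add: scalar_prod_def)

lemma all_less_4: "(\<forall>i<4::nat. P i) \<longleftrightarrow> P 0 \<and> P 1 \<and> P 2 \<and> P 3"
  by (simp add: eval_nat_numeral All_less_Suc conj_ac)

lemma all_less_8:
  "(\<forall>i<8::nat. P i) \<longleftrightarrow> P 0 \<and> P 1 \<and> P 2 \<and> P 3 \<and> P 4 \<and> P 5 \<and> P 6 \<and> P 7"
  by (simp add: eval_nat_numeral All_less_Suc conj_ac)

lemma sum_less_4: "(\<Sum>k = 0..<4::nat. f k) = f 0 + f 1 + f 2 + (f 3 :: complex)"
  by (simp add: eval_nat_numeral)

lemma sum_less_8:
  "(\<Sum>k = 0..<8::nat. f k) = f 0 + f 1 + f 2 + f 3 + f 4 + f 5 + f 6 + (f 7 :: complex)"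
  by (simp add: eval_nat_numeral)

text \<open>
  The corner entries multiply as scalars, and the middle block is \<open>c + b \<sigma>\<close> for the swap
  \<open>\<sigma>\<close> with \<open>\<sigma>\<^sup>2 = 1\<close>.
\<close>
lemma six_vertex_mult:
  "six_vertex a b c * six_vertex a' b' c' = six_vertex (a * a') (b * c' + c * b') (c * c' + b * b')"
proof (rule square_mat_eqI[where n = 4])
  show "\<forall>i<4. \<forall>j<4. (six_vertex a b c * six_vertex a' b' c') $$ (i, j)
      = six_vertex (a * a') (b * c' + c * b') (c * c' + b * b') $$ (i, j)"
    unfolding all_less_4
    by (simp del: index_mult_mat add: index_square_mult[OF six_vertex_carrier six_vertex_carrier] sum_less_4)
      (simp add: six_vertex_def)
qed (auto intro: mult_carrier_mat[where n = 4])

lemma six_vertex_smult: "k \<cdot>\<^sub>m six_vertex a b c = six_vertex (k * a) (k * b) (k * c)"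
proof (rule square_mat_eqI[where n = 4])
  show "\<forall>i<4. \<forall>j<4. (k \<cdot>\<^sub>m six_vertex a b c) $$ (i, j)
      = six_vertex (k * a) (k * b) (k * c) $$ (i, j)"
    unfolding all_less_4 by simp (simp add: six_vertex_def)
qed auto

lemma six_vertex_minus:
  "six_vertex a b c - six_vertex a' b' c' = six_vertex (a - a') (b - b') (c - c')"
proof (rule square_mat_eqI[where n = 4])
  show "\<forall>i<4. \<forall>j<4. (six_vertex a b c - six_vertex a' b' c') $$ (i, j)
      = six_vertex (a - a') (b - b') (c - c') $$ (i, j)"
    unfolding all_less_4 by simp (simp add: six_vertex_def)
qed (auto intro: minus_carrier_mat)

lemma one_eq_six_vertex: "1\<^sub>m 4 = six_vertex 1 0 1"
proof (rule square_mat_eqI[where n = 4])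
  show "\<forall>i<4. \<forall>j<4. 1\<^sub>m 4 $$ (i, j) = six_vertex 1 0 1 $$ (i, j)"
    unfolding all_less_4 by (simp add: six_vertex_def)
qed auto

lemma kron_one_one: "1\<^sub>m 2 \<otimes>\<^sub>K 1\<^sub>m 2 = 1\<^sub>m 4"
proof (rule square_mat_eqI[where n = 4])
  show "\<forall>i<4. \<forall>j<4. (1\<^sub>m 2 \<otimes>\<^sub>K 1\<^sub>m 2) $$ (i, j) = 1\<^sub>m 4 $$ (i, j)"
    unfolding all_less_4 by (simp add: kron_def)
qed (auto simp: kron_def)

section \<open>The star-triangle relations\<close>

lemma leg_carrier:
  assumes "M \<in> carrier_mat 4 4"
  shows "leg12 M \<in> carrier_mat 8 8" and "leg23 M \<in> carrier_mat 8 8"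
  using assms by (auto simp: leg12_def leg23_def kron_def)

lemma leg12_six_vertex:
  "leg12 (six_vertex a b c) = mat_of_rows_list 8
     [[a, 0, 0, 0, 0, 0, 0, 0],
      [0, a, 0, 0, 0, 0, 0, 0],
      [0, 0, c, 0, b, 0, 0, 0],
      [0, 0, 0, c, 0, b, 0, 0],
      [0, 0, b, 0, c, 0, 0, 0],
      [0, 0, 0, b, 0, c, 0, 0],
      [0, 0, 0, 0, 0, 0, a, 0],
      [0, 0, 0, 0, 0, 0, 0, a]]"
  (is "?L = ?R")
proof (rule square_mat_eqI[where n = 8])
  show "\<forall>i<8. \<forall>j<8. ?L $$ (i, j) = ?R $$ (i, j)"
    unfolding all_less_8 by (simp add: leg12_def kron_def) (simp add: six_vertex_def)
qed (auto intro: mat_of_rows_list_square leg_carrier)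

lemma leg23_six_vertex:
  "leg23 (six_vertex a b c) = mat_of_rows_list 8
     [[a, 0, 0, 0, 0, 0, 0, 0],
      [0, c, b, 0, 0, 0, 0, 0],
      [0, b, c, 0, 0, 0, 0, 0],
      [0, 0, 0, a, 0, 0, 0, 0],
      [0, 0, 0, 0, a, 0, 0, 0],
      [0, 0, 0, 0, 0, c, b, 0],
      [0, 0, 0, 0, 0, b, c, 0],
      [0, 0, 0, 0, 0, 0, 0, a]]"
  (is "?L = ?R")
proof (rule square_mat_eqI[where n = 8])
  show "\<forall>i<8. \<forall>j<8. ?L $$ (i, j) = ?R $$ (i, j)"
    unfolding all_less_8 by (simp add: leg23_def kron_def) (simp add: six_vertex_def)
qed (auto intro: mat_of_rows_list_square leg_carrier)

lemma leg12_leg23: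
  "leg12 (six_vertex a b c) * leg23 (six_vertex a' b' c') = mat_of_rows_list 8
     [[a * a', 0, 0, 0, 0, 0, 0, 0],
      [0, a * c', a * b', 0, 0, 0, 0, 0],
      [0, c * b', c * c', 0, b * a', 0, 0, 0],
      [0, 0, 0, c * a', 0, b * c', b * b', 0],
      [0, b * b', b * c', 0, c * a', 0, 0, 0],
      [0, 0, 0, b * a', 0, c * c', c * b', 0],
      [0, 0, 0, 0, 0, a * b', a * c', 0],
      [0, 0, 0, 0, 0, 0, 0, a * a']]"
  (is "?L = ?R")
proof (rule square_mat_eqI[where n = 8])
  show "\<forall>i<8. \<forall>j<8. ?L $$ (i, j) = ?R $$ (i, j)"
    unfolding all_less_8
    by (simp add: index_square_mult[where n = 8] leg_carrier sum_less_8)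
      (simp add: leg12_six_vertex leg23_six_vertex)
qed (auto intro!: mat_of_rows_list_square leg_carrier mult_carrier_mat[where n = 8])

lemma leg23_leg12:
  "leg23 (six_vertex a b c) * leg12 (six_vertex a' b' c') = mat_of_rows_list 8
     [[a * a', 0, 0, 0, 0, 0, 0, 0],
      [0, c * a', b * c', 0, b * b', 0, 0, 0],
      [0, b * a', c * c', 0, c * b', 0, 0, 0],
      [0, 0, 0, a * c', 0, a * b', 0, 0],
      [0, 0, a * b', 0, a * c', 0, 0, 0],
      [0, 0, 0, c * b', 0, c * c', b * a', 0],
      [0, 0, 0, b * b', 0, b * c', c * a', 0],
      [0, 0, 0, 0, 0, 0, 0, a * a']]"
  (is "?L = ?R")
proof (rule square_mat_eqI[where n = 8])
  show "\<forall>i<8. \<forall>j<8. ?L $$ (i, j) = ?R $$ (i, j)"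
    unfolding all_less_8
    by (simp add: index_square_mult[where n = 8] leg_carrier sum_less_8)
      (simp add: leg12_six_vertex leg23_six_vertex)
qed (auto intro!: mat_of_rows_list_square leg_carrier mult_carrier_mat[where n = 8])

text \<open>
  The relations come from the basis vectors with exactly one factor \<open>e\<^sub>2\<close>; those
  with two factors \<open>e\<^sub>2\<close> give the same relations because of the symmetry
  \<open>e\<^sub>1 \<leftrightarrow> e\<^sub>2\<close>, and the remaining entries agree by commutativity.
\<close>
lemma star_triangle:
  assumes "a1 * c2 * a3 = c1 * a2 * c3 + b1 * c2 * b3"
    and "c1 * b2 * a3 = c1 * a2 * b3 + b1 * c2 * c3"
    and "a1 * b2 * c3 = b1 * a2 * c3 + c1 * c2 * b3"
  shows "leg12 (six_vertex a1 b1 c1) * leg23 (six_vertex a2 b2 c2) * leg12 (six_vertex a3 b3 c3)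
       = leg23 (six_vertex a3 b3 c3) * leg12 (six_vertex a2 b2 c2) * leg23 (six_vertex a1 b1 c1)"
proof -
  \<comment> \<open>The partial products stay opaque while the outer product is expanded, so that each entry
    is a sum of 8 rather than of 64 terms.\<close>
  define X where "X = leg12 (six_vertex a1 b1 c1) * leg23 (six_vertex a2 b2 c2)"
  define Y where "Y = leg23 (six_vertex a3 b3 c3) * leg12 (six_vertex a2 b2 c2)"
  have carriers: "X \<in> carrier_mat 8 8" "Y \<in> carrier_mat 8 8"
    by (auto simp: X_def Y_def intro!: leg_carrier mult_carrier_mat[where n = 8])
  have "X * leg12 (six_vertex a3 b3 c3) = Y * leg23 (six_vertex a1 b1 c1)" (is "?L = ?R")
  proof (rule square_mat_eqI[where n = 8])
    show "\<forall>i<8. \<forall>j<8. ?L $$ (i, j) = ?R $$ (i, j)"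
      unfolding all_less_8
      apply (simp only: index_square_mult[where n = 8] leg_carrier six_vertex_carrier carriers
          sum_less_8 rel_simps simp_thms)
      apply (simp only: X_def Y_def leg12_leg23 leg23_leg12)
      apply (simp only: leg12_six_vertex leg23_six_vertex)
      apply simp
      using assms by (simp add: ac_simps)
  qed (use carriers in \<open>auto intro!: leg_carrier mult_carrier_mat[where n = 8]\<close>)
  then show ?thesis by (simp only: X_def Y_def)
qed

section \<open>Closed forms\<close>

lemma R_check_six_vertex: "R_check w j = six_vertex (w ^ j) (w powi (- int j)) 0"
  by (simp add: R_check_def six_vertex_def)

lemma R_check_inverse:
  assumes "w \<noteq> 0"
  shows "invertible_mat (R_check w j)"
    and "the (mat_inverse (R_check w j)) = six_vertex (w powi (- int j)) (w ^ j) 0"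
proof -
  let ?R = "R_check w j" and ?Q = "six_vertex (w powi (- int j)) (w ^ j) 0"
  have R: "?R \<in> carrier_mat 4 4" and Q: "?Q \<in> carrier_mat 4 4"
    by (simp_all add: R_check_six_vertex)
  have 1: "?R * ?Q = 1\<^sub>m 4" and 2: "?Q * ?R = 1\<^sub>m 4"
    using assms
    by (simp_all add: R_check_six_vertex six_vertex_mult one_eq_six_vertex power_int_minus)
  show "invertible_mat ?R"
    using 1 2 R Q unfolding invertible_mat_def inverts_mat_def
    by (auto intro!: exI[of _ ?Q])
  obtain B where B: "mat_inverse ?R = Some B"
    using mat_inverse(1)[OF R] 1 2 R Q
    by (cases "mat_inverse ?R") (auto simp: Units_def ring_mat_def)
  have "B * ?R = 1\<^sub>m 4" "B \<in> carrier_mat 4 4"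
    using mat_inverse(2)[OF R B] by auto
  then have "B = B * (?R * ?Q)"
    by (simp add: 1)
  also have "\<dots> = (B * ?R) * ?Q"
    using \<open>B \<in> carrier_mat 4 4\<close> R Q by (simp only: assoc_mult_mat)
  also have "\<dots> = ?Q"
    using \<open>B * ?R = 1\<^sub>m 4\<close> Q by simp
  finally have "B = ?Q" .
  then show "the (mat_inverse ?R) = ?Q" using B by simp
qed

lemma powi_exponents:
  fixes w :: complex
  assumes "w \<noteq> 0"
  shows "w powi (- int j) = inverse (w ^ j)"
    and "w powi (- 2 * int j) = inverse (w ^ j) ^ 2"
    and "w powi (- 3 * int j) = inverse (w ^ j) ^ 3"
    and "w powi (- 4 * int j) = inverse (w ^ j) ^ 4"
proof -
  have *: "w powi (- (int k * int j)) = inverse (w ^ j) ^ k" for k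
  proof -
    have "w powi (- (int k * int j)) = inverse (w ^ (j * k))"
      by (simp add: power_int_minus mult.commute flip: of_nat_mult)
    then show ?thesis by (simp add: power_mult power_inverse)
  qed
  show "w powi (- int j) = inverse (w ^ j)"
    and "w powi (- 2 * int j) = inverse (w ^ j) ^ 2"
    and "w powi (- 3 * int j) = inverse (w ^ j) ^ 3"
    and "w powi (- 4 * int j) = inverse (w ^ j) ^ 4"
    using *[of 1] *[of 2] *[of 3] *[of 4] by simp_all
qed

lemma R_check_spec_six_vertex:
  assumes "w \<noteq> 0"
  shows "R_check_spec w j x = six_vertex
    (w ^ j - w powi (- 3 * int j) * x ^ 2)
    (- (w powi (- int j)) * (x ^ 2 - 1))
    ((w ^ j - w powi (- 3 * int j)) * x)"
proof -
  define p where "p = w ^ j"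
  have p: "p \<noteq> 0" using assms by (simp add: p_def)
  show ?thesis
    unfolding R_check_spec_def R_check_inverse(2)[OF assms] kron_one_one one_eq_six_vertex
    unfolding R_check_six_vertex six_vertex_smult six_vertex_minus
      powi_exponents[OF assms] p_def[symmetric]
    using p by (intro arg_cong3[where f = six_vertex])
      (simp_all add: field_simps power2_eq_square power3_eq_cube)
qed

section \<open>The braiding equation\<close>

lemma leg12_smult: "M \<in> carrier_mat 4 4 \<Longrightarrow> leg12 (k \<cdot>\<^sub>m M) = k \<cdot>\<^sub>m leg12 M"
  by (intro eq_matI) (auto simp: leg12_def kron_def less_mult_imp_div_less)

lemma leg23_smult: "M \<in> carrier_mat 4 4 \<Longrightarrow> leg23 (k \<cdot>\<^sub>m M) = k \<cdot>\<^sub>m leg23 M"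
  by (intro eq_matI) (auto simp: leg23_def kron_def)

lemma smult_triple_mult:
  fixes A B C :: "complex mat"
  assumes "A \<in> carrier_mat n n" "B \<in> carrier_mat n n" "C \<in> carrier_mat n n"
  shows "(k \<cdot>\<^sub>m A) * (l \<cdot>\<^sub>m B) * (m \<cdot>\<^sub>m C) = (k * l * m) \<cdot>\<^sub>m (A * B * C)"
proof -
  have smult_smult: "r \<cdot>\<^sub>m (s \<cdot>\<^sub>m M) = (r * s) \<cdot>\<^sub>m M" for r s :: complex and M
    by (rule eq_matI) auto
  have "(k \<cdot>\<^sub>m A) * (l \<cdot>\<^sub>m B) = (k * l) \<cdot>\<^sub>m (A * B)"
    using assms mult_smult_assoc_mat[of A n n "l \<cdot>\<^sub>m B" n k] mult_smult_distrib[of A n n B n l]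
    by (simp add: smult_smult)
  moreover have "((k * l) \<cdot>\<^sub>m (A * B)) * (m \<cdot>\<^sub>m C) = (k * l * m) \<cdot>\<^sub>m (A * B * C)"
    using assms mult_smult_assoc_mat[of "A * B" n n "m \<cdot>\<^sub>m C" n "k * l"]
      mult_smult_distrib[of "A * B" n n C n m]
    by (simp add: smult_smult)
  ultimately show ?thesis by simp
qed

lemma braiding_YBE_smult:
  assumes T: "braiding_YBE T" and carrier: "\<And>x. T x \<in> carrier_mat 4 4"
  shows "braiding_YBE (\<lambda>x. f x \<cdot>\<^sub>m T x)"
  unfolding braiding_YBE_def
proof (intro allI impI)
  fix x z :: complex
  assume "x \<noteq> 0" "z \<noteq> 0"
  then have eq: "leg12 (T x) * leg23 (T (x * z)) * leg12 (T z)
      = leg23 (T z) * leg12 (T (x * z)) * leg23 (T x)"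
    using T by (simp add: braiding_YBE_def)
  have scalars: "f x * f (x * z) * f z = f z * f (x * z) * f x"
    by simp
  show "leg12 (f x \<cdot>\<^sub>m T x) * leg23 (f (x * z) \<cdot>\<^sub>m T (x * z)) * leg12 (f z \<cdot>\<^sub>m T z)
      = leg23 (f z \<cdot>\<^sub>m T z) * leg12 (f (x * z) \<cdot>\<^sub>m T (x * z)) * leg23 (f x \<cdot>\<^sub>m T x)"
    unfolding leg12_smult[OF carrier] leg23_smult[OF carrier]
      smult_triple_mult[OF leg_carrier(1)[OF carrier] leg_carrier(2)[OF carrier] leg_carrier(1)[OF carrier]]
      smult_triple_mult[OF leg_carrier(2)[OF carrier] leg_carrier(1)[OF carrier] leg_carrier(2)[OF carrier]]
      eq scalars ..
qed

text \<open>
  Since \<open>c x * c z = (p - r) * c (x * z)\<close>, a factor \<open>c (x * z)\<close> splits off, and the first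
  star-triangle relation says that
  \<open>a x * a z\<close> and \<open>(p - r) * a (x * z) + s\<^sup>2 (x\<^sup>2 - 1) (z\<^sup>2 - 1)\<close> agree;
  their difference is \<open>(p r - s\<^sup>2) (x\<^sup>2 - 1) (z\<^sup>2 - 1)\<close>.
  The other two relations hold for all \<open>p\<close>, \<open>r\<close>, \<open>s\<close>.
\<close>
lemma trigonometric_six_vertex_YBE:
  fixes p r s :: complex
  assumes "p * r = s\<^sup>2"
  defines "a \<equiv> \<lambda>x. p - r * x\<^sup>2" and "b \<equiv> \<lambda>x. - s * (x\<^sup>2 - 1)" and "c \<equiv> \<lambda>x. (p - r) * x"
  shows "braiding_YBE (\<lambda>x. six_vertex (a x) (b x) (c x))"
  unfolding braiding_YBE_def
proof (intro allI impI, rule star_triangle)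
  fix x z :: complex
  have "a x * c (x * z) * a z - (c x * a (x * z) * c z + b x * c (x * z) * b z)
      = c (x * z) * (x\<^sup>2 - 1) * (z\<^sup>2 - 1) * (p * r - s\<^sup>2)"
    by (simp add: a_def b_def c_def algebra_simps power2_eq_square)
  then show "a x * c (x * z) * a z = c x * a (x * z) * c z + b x * c (x * z) * b z"
    using assms(1) by simp
  show "c x * b (x * z) * a z = c x * a (x * z) * b z + b x * c (x * z) * c z"
    by (simp add: a_def b_def c_def algebra_simps power2_eq_square)
  show "a x * b (x * z) * c z = b x * a (x * z) * c z + c x * c (x * z) * b z"
    by (simp add: a_def b_def c_def algebra_simps power2_eq_square)
qed

lemma braiding_YBE_R_check_spec:
  assumes "w \<noteq> 0"
  shows "braiding_YBE (R_check_spec w j)"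
proof -
  have "w ^ j * w powi (- 3 * int j) = (w powi (- int j))\<^sup>2"
    unfolding powi_exponents[OF assms] using assms
    by (simp add: power2_eq_square power3_eq_cube)
  from trigonometric_six_vertex_YBE[OF this] show ?thesis
    by (simp only: R_check_spec_six_vertex[OF assms, abs_def])
qed

section \<open>The rescaled matrix\<close>

lemma S_check_six_vertex:
  assumes "w \<noteq> 0" and "x \<noteq> 0"
  shows "S_check w j x = six_vertex
    (w ^ (2 * j) * inverse x - w powi (- 2 * int j) * x)
    (inverse x - x)
    (w ^ (2 * j) - w powi (- 2 * int j))"
proof -
  define p where "p = w ^ j"
  have p: "p \<noteq> 0" using assms by (simp add: p_def)
  have p2: "w ^ (2 * j) = p ^ 2"
    by (simp add: p_def mult.commute power_mult)
  show ?thesis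
    unfolding S_check_def R_check_spec_six_vertex[OF assms(1)] six_vertex_smult
      powi_exponents[OF assms(1)] p2 p_def[symmetric]
    using p assms(2) by (intro arg_cong3[where f = six_vertex])
      (simp_all add: field_simps power2_eq_square power3_eq_cube)
qed

text \<open>
  With \<open>q = \<omega>\<^sup>2\<^sup>j\<close>, inverting \<open>x\<close> negates \<open>b = x\<^sup>-\<^sup>1 - x\<close> and fixes \<open>c = q - q\<^sup>-\<^sup>1\<close>, so the
  off-diagonal entries of the product cancel. Its middle diagonal entry
  \<open>c\<^sup>2 - b\<^sup>2 = q\<^sup>2 + q\<^sup>-\<^sup>2 - x\<^sup>2 - x\<^sup>-\<^sup>2\<close> is also the product of the corner entries
  \<open>q x\<^sup>-\<^sup>1 - q\<^sup>-\<^sup>1 x\<close> and \<open>q x - q\<^sup>-\<^sup>1 x\<^sup>-\<^sup>1\<close>.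
\<close>
lemma S_check_unitarity:
  assumes "w \<noteq> 0" and "x \<noteq> 0"
  shows "S_check w j x * S_check w j (inverse x)
    = (w ^ (4 * j) + w powi (- 4 * int j) - (x ^ 2 + x powi (- 2))) \<cdot>\<^sub>m (1\<^sub>m 2 \<otimes>\<^sub>K 1\<^sub>m 2)"
proof -
  define p where "p = w ^ j"
  have p: "p \<noteq> 0" using assms by (simp add: p_def)
  have pp: "w ^ (2 * j) = p ^ 2" "w ^ (4 * j) = p ^ 4"
    by (simp_all add: p_def mult.commute power_mult)
  have x2: "x powi (- 2) = inverse x ^ 2"
    by (simp add: power_int_minus power_inverse)
  have ix: "inverse x \<noteq> 0" using assms(2) by simp
  show ?thesis
    unfolding S_check_six_vertex[OF assms] S_check_six_vertex[OF assms(1) ix]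
      kron_one_one one_eq_six_vertex six_vertex_mult six_vertex_smult
      powi_exponents[OF assms(1)] pp x2 p_def[symmetric]
    using p assms(2) by (intro arg_cong3[where f = six_vertex])
      (simp_all add: field_simps power2_eq_square power4_eq_xxxx)
qed

theorem mainTheorem3:
  fixes n j :: nat and w :: complex
  assumes "n > 0" and "j < n"
    and "w = exp (2 * of_real pi * \<i> / of_nat n)"
  shows "invertible_mat (R_check w j)
    \<and> (\<forall>x. R_check_spec w j x = mat_of_rows_list 4
        [[w ^ j - w powi (- 3 * int j) * x ^ 2, 0, 0, 0],
         [0, (w ^ j - w powi (- 3 * int j)) * x, - (w powi (- int j)) * (x ^ 2 - 1), 0],
         [0, - (w powi (- int j)) * (x ^ 2 - 1), (w ^ j - w powi (- 3 * int j)) * x, 0],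
         [0, 0, 0, w ^ j - w powi (- 3 * int j) * x ^ 2]])
    \<and> braiding_YBE (R_check_spec w j)
    \<and> (\<forall>x. x \<noteq> 0 \<longrightarrow> S_check w j x = mat_of_rows_list 4
        [[w ^ (2 * j) * inverse x - w powi (- 2 * int j) * x, 0, 0, 0],
         [0, w ^ (2 * j) - w powi (- 2 * int j), inverse x - x, 0],
         [0, inverse x - x, w ^ (2 * j) - w powi (- 2 * int j), 0],
         [0, 0, 0, w ^ (2 * j) * inverse x - w powi (- 2 * int j) * x]])
    \<and> braiding_YBE (S_check w j)
    \<and> (\<forall>x. x \<noteq> 0 \<longrightarrow> S_check w j x * S_check w j (inverse x)
        = (w ^ (4 * j) + w powi (- 4 * int j) - (x ^ 2 + x powi (- 2))) \<cdot>\<^sub>m (1\<^sub>m 2 \<otimes>\<^sub>K 1\<^sub>m 2))"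
proof -
  have w: "w \<noteq> 0" using assms(3) by simp
  have "braiding_YBE (S_check w j)"
    using braiding_YBE_smult[OF braiding_YBE_R_check_spec[OF w, of j],
        of "\<lambda>x. w ^ j * inverse x"]
    by (simp add: S_check_def[abs_def] R_check_spec_six_vertex[OF w])
  then show ?thesis
    using R_check_inverse(1)[OF w] braiding_YBE_R_check_spec[OF w] S_check_unitarity[OF w]
    unfolding six_vertex_def[symmetric]
    by (simp add: R_check_spec_six_vertex[OF w] S_check_six_vertex[OF w])
qed

end
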